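(* Let $r_1=a+bi$ (with $a,b\in\mathbb{R}$) be such that $0<a<1$ and $|b|<\sqrt{\frac{a}{2-a}-a^2}$, and let $r_2\in\mathbb{C}\setminus\{0\}$ be arbitrary. Suppose the parameters of the matrix $A$ satisfy at least one of the following: (1) $b_0=-\frac1{r_1}-\frac1{r_2}$ and $b_1=\frac{1}{r_1r_2}$, with $c_0,c_{-1}$ arbitrary; (2) $c_0=-\frac1{r_1}-\frac1{r_2}$ and $c_{-1}=\frac1{r_1r_2}$, with $b_0,b_1$ arbitrary. Then for sufficiently large $n$ the system $\ddot x=q(A-2I)x$ is unstable, whereas the system with periodic boundary conditions imposed, $\ddot x=qLx$, is Lyapunov stable.
   Context: $n$ is a positive integer, $q>0$ is a constant, and the parameters $b_0,b_1,c_{-1},c_0\in\mathbb{C}$ are fixed independently of $n$. $A=A_{n+1}$ is the complex tridiagonal $(n+1)\times(n+1)$ matrix with rows and columns indexed by $0,\dots,n$, whose nonzero entries are: $A_{0,0}=-b_0$, $A_{0,1}=1-b_1$; $A_{k,k-1}=A_{k,k+1}=1$ for $1\le k\le n-1$; $A_{n,n-1}=1-c_{-1}$, $A_{n,n}=-c_0$; all other entries are $0$. $I$ is the identity. $L=L_{n+1}$ is the $(n+1)\times(n+1)$ circulant matrix with diagonal entries $-2$, sub- and super-diagonal entries $1$, entries $1$ in the upper right and lower left corners, and all other entries $0$. The second-order systems are regarded as linear first-order systems in $(x,\dot x)$.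
   Formalization: Since the periodic system has the uniform drift x_k(t) = tv, it is not Lyapunov stable for all initial data as claimed; its stability is stated only for initial data with zero mean velocity, and instability of the other system is shown both for all initial data and for such data. *)

theory Defs
  imports "HOL-Analysis.L2_Norm" "Jordan_Normal_Form.Matrix"
begin

definition boundary_mat :: "complex \<Rightarrow> complex \<Rightarrow> complex \<Rightarrow> complex \<Rightarrow> nat \<Rightarrow> complex mat" where
  "boundary_mat b0 b1 cm1 c0 n = mat (n + 1) (n + 1) (\<lambda>(i, j).
     if i = 0 \<and> j = 0 then - b0
     else if i = 0 \<and> j = 1 then 1 - b1
     else if i = n \<and> j = n - 1 then 1 - cm1
     else if i = n \<and> j = n then - c0
     else if 1 \<le> i \<and> i < n \<and> (j = i - 1 \<or> j = i + 1) then 1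
     else 0)"

definition periodic_mat :: "nat \<Rightarrow> complex mat" where
  "periodic_mat n = mat (n + 1) (n + 1) (\<lambda>(i, j).
     if i = j then - 2
     else if j = (i + 1) mod (n + 1) \<or> i = (j + 1) mod (n + 1) then 1
     else 0)"

text \<open>The second-order system \<open>x'' = B x\<close> as a first-order system in the phase vector
  \<open>z = (x, x')\<close>: positions are the entries \<open>0, \<dots>, m - 1\<close> of \<open>z\<close>, velocities the entries
  \<open>m, \<dots>, 2 m - 1\<close>.\<close>

definition first_order :: "complex mat \<Rightarrow> complex mat" where
  "first_order B = (let m = dim_row B in four_block_mat (0\<^sub>m m m) (1\<^sub>m m) B (0\<^sub>m m m))"

definition is_solution :: "complex mat \<Rightarrow> (real \<Rightarrow> complex vec) \<Rightarrow> bool" where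
  "is_solution M z \<longleftrightarrow>
     (\<forall>t\<ge>0. z t \<in> carrier_vec (dim_row M) \<and>
        (\<forall>i < dim_row M. ((\<lambda>s. z s $ i) has_vector_derivative (M *\<^sub>v z t) $ i) (at t within {0..})))"

definition eucl_norm :: "complex vec \<Rightarrow> real" where
  "eucl_norm v = L2_set (\<lambda>i. cmod (v $ i)) {..<dim_vec v}"

text \<open>Lyapunov stability of the equilibrium \<open>0\<close> of \<open>z' = M z\<close> under perturbations of the initial
  state that lie in \<open>V\<close>.\<close>

definition lyapunov_stable_on :: "complex vec set \<Rightarrow> complex mat \<Rightarrow> bool" where
  "lyapunov_stable_on V M \<longleftrightarrow>
     (\<forall>\<epsilon>>0. \<exists>\<delta>>0. \<forall>z. is_solution M z \<and> z 0 \<in> V \<and> eucl_norm (z 0) < \<delta> \<longrightarrow>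
        (\<forall>t\<ge>0. eucl_norm (z t) < \<epsilon>))"

definition lyapunov_stable :: "complex mat \<Rightarrow> bool" where
  "lyapunov_stable M \<longleftrightarrow> lyapunov_stable_on UNIV M"

definition zero_mean_velocity :: "nat \<Rightarrow> complex vec set" where
  "zero_mean_velocity m = {z \<in> carrier_vec (2 * m). (\<Sum>i<m. z $ (m + i)) = 0}"

text \<open>Periodic boundary conditions leave the uniform drift \<open>x\<^sub>k(t) = t v\<close> as a solution, so that
  full Lyapunov stability fails for \<open>x'' = q L x\<close>.  On \<open>zero_mean_velocity\<close>, which is invariant
  under this system and excludes exactly the drift, stability is the meaningful notion.\<close>

lemma periodic_mat_row_sum:
  assumes "n \<ge> 2" "i < n + 1"
  shows "(\<Sum>j<n + 1. periodic_mat n $$ (i, j)) = 0"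
proof -
  define s where "s = (if i = n then 0 else i + 1)"
  define p where "p = (if i = 0 then n else i - 1)"
  have neq: "s \<noteq> p" "s \<noteq> i" "p \<noteq> i" and lt: "s < n + 1" "p < n + 1"
    unfolding s_def p_def using assms by (auto split: if_splits)
  have e: "periodic_mat n $$ (i, j)
      = (if j = i then -2 else 0) + (if j = s then 1 else 0) + (if j = p then 1 else 0)"
    if "j < n + 1" for j
  proof -
    have "(i + 1) mod (n + 1) = s" unfolding s_def using assms by auto
    moreover have "i = (j + 1) mod (n + 1) \<longleftrightarrow> j = p"
      unfolding p_def using that assms by (cases "j = n") auto
    moreover have "periodic_mat n $$ (i, j) = (if i = j then - 2
        else if j = (i + 1) mod (n + 1) \<or> i = (j + 1) mod (n + 1) then 1 else 0)"
      using that assms(2) by (simp add: periodic_mat_def)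
    ultimately have "periodic_mat n $$ (i, j) = (if i = j then - 2
        else if j = s \<or> j = p then 1 else 0)" by simp
    then show ?thesis using neq by simp
  qed
  have "(\<Sum>j<n + 1. periodic_mat n $$ (i, j)) = (\<Sum>j<n + 1.
      (if j = i then -2 else 0) + (if j = s then 1 else 0) + (if j = p then 1 else 0))"
    using e by (intro sum.cong) auto
  also have "\<dots> = 0"
    unfolding sum.distrib using lt assms(2) by simp
  finally show ?thesis .
qed

lemma not_lyapunov_stable_periodic:
  assumes "n \<ge> 2"
  shows "\<not> lyapunov_stable (first_order (complex_of_real q \<cdot>\<^sub>m periodic_mat n))"
proof
  define m where "m = n + 1"
  let ?B = "complex_of_real q \<cdot>\<^sub>m periodic_mat n"
  let ?M = "first_order ?B"
  have dB: "dim_row ?B = m" "dim_col ?B = m" by (auto simp: periodic_mat_def m_def)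
  have dM: "dim_row ?M = 2 * m" "dim_col ?M = 2 * m" using dB by (auto simp: first_order_def Let_def)
  define z :: "real \<Rightarrow> real \<Rightarrow> complex vec" where
    "z = (\<lambda>\<eta> t. vec (2 * m) (\<lambda>i. complex_of_real (if i < m then t * \<eta> else \<eta>)))"
  have z_eq: "z \<eta> t = vec m (\<lambda>_. complex_of_real (t * \<eta>)) @\<^sub>v vec m (\<lambda>_. complex_of_real \<eta>)" for \<eta> t
    unfolding z_def by (intro eq_vecI) auto
  have B0: "?B *\<^sub>v vec m (\<lambda>_. c) = 0\<^sub>v m" for c
  proof (intro eq_vecI)
    fix i assume "i < dim_vec (0\<^sub>v m :: complex vec)"
    then have i: "i < n + 1" by (simp add: m_def)
    have "(?B *\<^sub>v vec m (\<lambda>_. c)) $ i = (\<Sum>j<n + 1. complex_of_real q * periodic_mat n $$ (i, j) * c)"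
      using i by (simp add: scalar_prod_def m_def periodic_mat_def atLeast0LessThan)
    also have "\<dots> = complex_of_real q * (\<Sum>j<n + 1. periodic_mat n $$ (i, j)) * c"
      by (simp only: sum_distrib_left sum_distrib_right)
    also have "\<dots> = 0" using periodic_mat_row_sum[OF assms i] by simp
    finally show "(?B *\<^sub>v vec m (\<lambda>_. c)) $ i = 0\<^sub>v m $ i" using i by (simp add: m_def)
  qed (use dB in auto)
  have Mz: "?M *\<^sub>v z \<eta> t = vec m (\<lambda>_. complex_of_real \<eta>) @\<^sub>v 0\<^sub>v m" for \<eta> t
  proof -
    have "?M *\<^sub>v z \<eta> t = (0\<^sub>m m m *\<^sub>v vec m (\<lambda>_. complex_of_real (t * \<eta>)) + 1\<^sub>m m *\<^sub>v vec m (\<lambda>_. complex_of_real \<eta>))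
       @\<^sub>v (?B *\<^sub>v vec m (\<lambda>_. complex_of_real (t * \<eta>)) + 0\<^sub>m m m *\<^sub>v vec m (\<lambda>_. complex_of_real \<eta>))"
      unfolding first_order_def Let_def dB z_eq
      by (rule four_block_mat_mult_vec) (use dB in auto)
    moreover have "0\<^sub>m m m *\<^sub>v vec m (\<lambda>_. c) = 0\<^sub>v m" for c :: complex
      by (intro eq_vecI) (simp_all add: scalar_prod_def)
    moreover have "1\<^sub>m m *\<^sub>v vec m (\<lambda>_. c) = vec m (\<lambda>_. c)" for c :: complex
      by (rule one_mult_mat_vec) simp
    moreover have "0\<^sub>v m + vec m (\<lambda>_. c) = vec m (\<lambda>_. c)" for c :: complex
      by (intro eq_vecI) simp_all
    moreover have "v + 0\<^sub>v m = v" if "v \<in> carrier_vec m" for v :: "complex vec"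
      using that by simp
    ultimately show ?thesis by (simp only: B0 zero_carrier_vec)
  qed
  have sol: "is_solution ?M (z \<eta>)" for \<eta>
    unfolding is_solution_def Mz dM
  proof (intro allI impI conjI)
    fix t :: real and i assume i: "i < 2 * m"
    have "((\<lambda>s. complex_of_real (s * \<eta>)) has_vector_derivative complex_of_real \<eta>) (at t within {0..})"
      by (auto intro!: derivative_eq_intros simp: has_vector_derivative_def scaleR_conv_of_real)
    then show "((\<lambda>s. z \<eta> s $ i) has_vector_derivative
        (vec m (\<lambda>_. complex_of_real \<eta>) @\<^sub>v 0\<^sub>v m) $ i) (at t within {0..})"
      using i by (cases "i < m") (simp_all add: z_def)
  qed (auto simp: z_def)
  have ge: "eucl_norm (z \<eta> t) \<ge> t * \<eta>" for \<eta> t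
  proof -
    have "cmod (z \<eta> t $ 0) \<le> eucl_norm (z \<eta> t)"
      unfolding eucl_norm_def by (rule member_le_L2_set) (auto simp: z_def m_def)
    moreover have "cmod (z \<eta> t $ 0) = \<bar>t * \<eta>\<bar>"
      unfolding z_def m_def by (simp add: norm_mult abs_mult)
    ultimately show ?thesis by linarith
  qed
  assume "lyapunov_stable ?M"
  then have "\<exists>\<delta>>0. \<forall>z. is_solution ?M z \<and> z 0 \<in> UNIV \<and> eucl_norm (z 0) < \<delta> \<longrightarrow>
      (\<forall>t\<ge>0. eucl_norm (z t) < 1)"
    unfolding lyapunov_stable_def lyapunov_stable_on_def by (rule allE[of _ 1]) simp
  then obtain \<delta> where \<delta>: "\<delta> > 0" and
    st: "\<And>z t. is_solution ?M z \<Longrightarrow> eucl_norm (z 0) < \<delta> \<Longrightarrow> t \<ge> 0 \<Longrightarrow> eucl_norm (z t) < 1"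
    by auto
  define \<eta> where "\<eta> = \<delta> / (2 * real m + 1)"
  have \<eta>: "\<eta> > 0" using \<delta> by (simp add: \<eta>_def add_nonneg_pos)
  have "eucl_norm (z \<eta> 0) \<le> (\<Sum>i<2 * m. cmod (z \<eta> 0 $ i))"
    unfolding eucl_norm_def using L2_set_le_sum[of "{..<2 * m}" "\<lambda>i. cmod (z \<eta> 0 $ i)"]
    by (simp add: z_def)
  also have "\<dots> \<le> (\<Sum>i<2 * m. \<eta>)" by (intro sum_mono) (use \<eta> in \<open>auto simp: z_def\<close>)
  also have "\<dots> = 2 * real m * \<eta>" by simp
  also have "\<dots> < (2 * real m + 1) * \<eta>" using \<eta> by (simp add: algebra_simps)
  also have "\<dots> = \<delta>" by (simp add: \<eta>_def add_nonneg_pos field_simps)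
  finally have "eucl_norm (z \<eta> (1 / \<eta>)) < 1" using st[OF sol] \<eta> by simp
  with ge[of "1 / \<eta>" \<eta>] \<eta> show False by simp
qed

end

theory Submission
  imports Defs "HOL-Complex_Analysis.Conformal_Mappings"
begin

unbundle no vec_syntax

text \<open>
  A sequence \<open>x\<^sub>k = \<alpha> u\<^sup>k + \<beta> u\<^sup>-\<^sup>k\<close> satisfies the interior rows of the eigenvalue equation
  \<open>A x = (u + 1/u) x\<close> for any \<open>\<alpha>\<close>, \<open>\<beta>\<close>; the two boundary rows are two linear conditions on \<open>\<alpha>\<close>
  and \<open>\<beta>\<close>, whose determinant vanishes exactly when
  \<open>S(u) = u\<^sup>2\<^sup>n T(u)\<close>.  Here \<open>S(u) = (1 + b\<^sub>0 u + b\<^sub>1 u\<^sup>2) (1 + c\<^sub>0 u + c\<^sub>-\<^sub>1 u\<^sup>2)\<close> and \<open>T\<close> is the product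
  of the two quadratics with reversed coefficients (\<open>boundary_mat_eigenvector\<close>).  Either
  hypothesis on the boundary parameters makes one factor of \<open>S\<close> equal to
  \<open>(1 - u/r\<^sub>1) (1 - u/r\<^sub>2)\<close>, so that \<open>S(r\<^sub>1) = 0\<close>.  Inside the unit disc the term \<open>u\<^sup>2\<^sup>n T(u)\<close> is
  exponentially small, and hence for large \<open>n\<close> the characteristic equation has a solution close to
  \<open>r\<^sub>1\<close> (\<open>eventually_root_near\<close>).

  The bound on \<open>b\<close> amounts to \<open>Re (r\<^sub>1 + 1/r\<^sub>1) > 2\<close>, and it implies \<open>\<bar>r\<^sub>1\<bar> < 1\<close>.  By continuity \<open>A - 2I\<close> thus has an
  eigenvalue with positive real part, and \<open>q\<close> times it is the square of some \<open>\<mu>\<close> with \<open>Re \<mu> > 0\<close>.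
  The solution \<open>x(t) = cosh (\<mu> t) x\<close> is unbounded and starts with zero velocity, so it refutes
  stability both for all initial states and for those of zero mean velocity
  (\<open>not_lyapunov_stable_on_if_eigenvector\<close>).

  For the periodic system, the energy
  \<open>\<Sum>\<^sub>i \<bar>x'\<^sub>i\<bar>\<^sup>2 + q \<Sum>\<^sub>i \<bar>x\<^sub>i\<^sub>+\<^sub>1 - x\<^sub>i\<bar>\<^sup>2\<close> is conserved; it bounds the velocities and the distances between
  positions.  It does not see a common translation of all positions, but when the mean velocity
  is zero the mean position is conserved too, and together these bound the whole state by a
  multiple of the initial one (\<open>lyapunov_stable_on_periodic\<close>).
\<close>

section \<open>Second-order systems in phase space\<close>

lemma first_order_mult_vec:
  assumes "B \<in> carrier_mat m m" "p \<in> carrier_vec m" "v \<in> carrier_vec m"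
  shows "first_order B *\<^sub>v (p @\<^sub>v v) = v @\<^sub>v (B *\<^sub>v p)"
proof -
  have "first_order B *\<^sub>v (p @\<^sub>v v)
      = (0\<^sub>m m m *\<^sub>v p + 1\<^sub>m m *\<^sub>v v) @\<^sub>v (B *\<^sub>v p + 0\<^sub>m m m *\<^sub>v v)"
    unfolding first_order_def Let_def using assms
    by (subst four_block_mat_mult_vec) auto
  moreover have "0\<^sub>m m m *\<^sub>v w = 0\<^sub>v m" if "w \<in> carrier_vec m" for w :: "complex Matrix.vec"
    using that by (intro eq_vecI) (auto simp: scalar_prod_def)
  ultimately show ?thesis using assms by simp
qed

lemma dim_first_order: "B \<in> carrier_mat m m \<Longrightarrow> dim_row (first_order B) = 2 * m"
  by (simp add: first_order_def Let_def)

text \<open>The form in which both halves of the theorem use solutions: positions and velocities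
  separately.\<close>

lemma is_solution_first_order_iff:
  assumes "B \<in> carrier_mat m m"
  shows "is_solution (first_order B) z \<longleftrightarrow>
    (\<forall>t\<ge>0. z t \<in> carrier_vec (2 * m) \<and>
       (\<forall>i<m. ((\<lambda>s. z s $ i) has_vector_derivative z t $ (m + i)) (at t within {0..}) \<and>
              ((\<lambda>s. z s $ (m + i)) has_vector_derivative
                 (B *\<^sub>v Matrix.vec m (\<lambda>j. z t $ j)) $ i) (at t within {0..})))"
    (is "_ \<longleftrightarrow> (\<forall>t\<ge>0. _ \<and> (\<forall>i<m. ?D t i))")
proof -
  have "(\<forall>i<2 * m. ((\<lambda>s. z s $ i) has_vector_derivative (first_order B *\<^sub>v z t) $ i) (at t within {0..}))
      \<longleftrightarrow> (\<forall>i<m. ?D t i)" (is "(\<forall>i<2 * m. ?F i) \<longleftrightarrow> _")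
    if z: "z t \<in> carrier_vec (2 * m)" for t
  proof -
    have split: "z t = Matrix.vec m (\<lambda>i. z t $ i) @\<^sub>v Matrix.vec m (\<lambda>i. z t $ (m + i))"
      using z by (intro eq_vecI) auto
    have Mz: "first_order B *\<^sub>v z t = Matrix.vec m (\<lambda>i. z t $ (m + i)) @\<^sub>v (B *\<^sub>v Matrix.vec m (\<lambda>j. z t $ j))"
      by (subst split, rule first_order_mult_vec[OF assms]) auto
    have "(\<forall>i<2 * m. ?F i) \<longleftrightarrow> (\<forall>i<m. ?F i \<and> ?F (m + i))"
    proof safe
      fix i assume *: "\<forall>i<m. ?F i \<and> ?F (m + i)" and i: "i < 2 * m"
      show "?F i"
      proof (cases "i < m")
        case False
        then obtain k where "i = m + k" "k < m" using i by (metis add_less_cancel_left le_Suc_ex mult_2 not_less)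
        then show ?thesis using * by blast
      qed (use * in blast)
    qed auto
    also have "\<dots> \<longleftrightarrow> (\<forall>i<m. ?D t i)"
      unfolding Mz using assms by (intro all_cong) simp
    finally show ?thesis .
  qed
  then show ?thesis
    unfolding is_solution_def dim_first_order[OF assms] by blast
qed

lemma smult_mat_mult_vec:
  fixes A :: "'a :: comm_semiring_0 mat"
  assumes "dim_vec x = dim_col A"
  shows "(c \<cdot>\<^sub>m A) *\<^sub>v x = c \<cdot>\<^sub>v (A *\<^sub>v x)"
  using assms by (intro eq_vecI) (auto simp: scalar_prod_def sum_distrib_left mult.assoc)

lemma eucl_norm_smult: "eucl_norm (c \<cdot>\<^sub>v v) = cmod c * eucl_norm v"
proof -
  have "eucl_norm (c \<cdot>\<^sub>v v) = L2_set (\<lambda>i. cmod c * cmod (v $ i)) {..<dim_vec v}"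
    unfolding eucl_norm_def by (intro L2_set_cong) (auto simp: norm_mult)
  then show ?thesis by (simp add: eucl_norm_def L2_set_right_distrib)
qed

lemma norm_entry_le_eucl_norm: "i < dim_vec v \<Longrightarrow> cmod (v $ i) \<le> eucl_norm v"
  unfolding eucl_norm_def by (rule member_le_L2_set) auto

lemma eucl_norm_nonneg: "0 \<le> eucl_norm v"
  by (simp add: eucl_norm_def L2_set_nonneg)

lemma eucl_norm_le:
  assumes "\<And>i. i < dim_vec v \<Longrightarrow> cmod (v $ i) \<le> K"
  shows "eucl_norm v \<le> real (dim_vec v) * K"
proof -
  have "eucl_norm v \<le> (\<Sum>i<dim_vec v. cmod (v $ i))"
    unfolding eucl_norm_def by (rule L2_set_le_sum) auto
  also have "\<dots> \<le> (\<Sum>i<dim_vec v. K)" by (rule sum_mono) (use assms in auto)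
  finally show ?thesis by simp
qed

lemma has_vector_derivative_cosh_sinh:
  fixes \<mu> :: complex
  shows "((\<lambda>s. cosh (\<mu> * of_real s)) has_vector_derivative \<mu> * sinh (\<mu> * of_real t)) (at t within S)"
    and "((\<lambda>s. \<mu> * sinh (\<mu> * of_real s)) has_vector_derivative \<mu>\<^sup>2 * cosh (\<mu> * of_real t)) (at t within S)"
proof -
  have "((\<lambda>w. cosh (\<mu> * w)) has_field_derivative \<mu> * sinh (\<mu> * w)) (at w)" for w
    by (auto intro!: derivative_eq_intros)
  from has_vector_derivative_real_field[OF this, of t S]
  show "((\<lambda>s. cosh (\<mu> * of_real s)) has_vector_derivative \<mu> * sinh (\<mu> * of_real t)) (at t within S)"
    by simp
  have "((\<lambda>w. \<mu> * sinh (\<mu> * w)) has_field_derivative \<mu>\<^sup>2 * cosh (\<mu> * w)) (at w)" for w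
    by (auto intro!: derivative_eq_intros simp: power2_eq_square)
  from has_vector_derivative_real_field[OF this, of t S]
  show "((\<lambda>s. \<mu> * sinh (\<mu> * of_real s)) has_vector_derivative \<mu>\<^sup>2 * cosh (\<mu> * of_real t)) (at t within S)"
    by simp
qed

text \<open>A linear lower bound suffices for unboundedness; it comes from \<open>e\<^sup>x - e\<^sup>-\<^sup>x \<ge> x\<close>.\<close>

lemma norm_cosh_ge:
  fixes z :: complex
  assumes "0 \<le> Re z"
  shows "Re z / 2 \<le> cmod (cosh z)"
proof -
  have "cmod (exp z) - cmod (exp (- z)) \<le> cmod (exp z + exp (- z))"
    using norm_diff_ineq by blast
  then have "exp (Re z) - exp (- Re z) \<le> cmod (exp z + exp (- z))"
    by simp
  moreover have "cmod (cosh z) = cmod (exp z + exp (- z)) / 2"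
    by (simp add: cosh_field_def norm_divide)
  moreover have "1 + Re z \<le> exp (Re z)" by (rule exp_ge_add_one_self)
  moreover have "exp (- Re z) \<le> 1" using assms by simp
  ultimately show ?thesis by linarith
qed

text \<open>The mode \<open>e\<^sup>\<mu>\<^sup>t\<close> alone would start with velocity \<open>\<mu> x\<close>, whose mean need not be zero.  Averaging it
  with \<open>e\<^sup>-\<^sup>\<mu>\<^sup>t\<close> gives a growing solution that starts at rest, so instability holds for every set of
  initial states that contains the states at rest.\<close>

lemma not_lyapunov_stable_on_if_eigenvector:
  assumes B: "B \<in> carrier_mat m m" and x: "x \<in> carrier_vec m" "x \<noteq> 0\<^sub>v m"
    and eig: "B *\<^sub>v x = \<mu>\<^sup>2 \<cdot>\<^sub>v x" and \<mu>: "0 < Re \<mu>"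
    and V: "{z \<in> carrier_vec (2 * m). \<forall>i<m. z $ (m + i) = 0} \<subseteq> V"
  shows "\<not> lyapunov_stable_on V (first_order B)"
proof
  define w :: "real \<Rightarrow> complex Matrix.vec" where
    "w t = (cosh (\<mu> * of_real t) \<cdot>\<^sub>v x) @\<^sub>v ((\<mu> * sinh (\<mu> * of_real t)) \<cdot>\<^sub>v x)" for t
  have w_carrier: "w t \<in> carrier_vec (2 * m)" for t
    unfolding w_def mult_2 using x by auto
  have sol: "is_solution (first_order B) (\<lambda>t. of_real \<eta> \<cdot>\<^sub>v w t)" for \<eta>
    unfolding is_solution_first_order_iff[OF B]
  proof (intro allI impI conjI)
    fix t :: real and i assume i: "i < m"
    have "Matrix.vec m (\<lambda>j. (of_real \<eta> \<cdot>\<^sub>v w t) $ j) = (of_real \<eta> * cosh (\<mu> * of_real t)) \<cdot>\<^sub>v x"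
      using x by (intro eq_vecI) (auto simp: w_def)
    then have "B *\<^sub>v Matrix.vec m (\<lambda>j. (of_real \<eta> \<cdot>\<^sub>v w t) $ j)
        = (of_real \<eta> * cosh (\<mu> * of_real t)) \<cdot>\<^sub>v (\<mu>\<^sup>2 \<cdot>\<^sub>v x)"
      using eig mult_mat_vec[OF B x(1)] by simp
    then have Bw: "(B *\<^sub>v Matrix.vec m (\<lambda>j. (of_real \<eta> \<cdot>\<^sub>v w t) $ j)) $ i
        = of_real \<eta> * (\<mu>\<^sup>2 * cosh (\<mu> * of_real t) * x $ i)"
      using x i by simp
    have 1: "((\<lambda>s. of_real \<eta> * (cosh (\<mu> * of_real s) * x $ i)) has_vector_derivative
        of_real \<eta> * (\<mu> * sinh (\<mu> * of_real t) * x $ i)) (at t within {0..})"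
      and 2: "((\<lambda>s. of_real \<eta> * (\<mu> * sinh (\<mu> * of_real s) * x $ i)) has_vector_derivative
        of_real \<eta> * (\<mu>\<^sup>2 * cosh (\<mu> * of_real t) * x $ i)) (at t within {0..})"
      by (intro has_vector_derivative_mult_right has_vector_derivative_mult_left
          has_vector_derivative_cosh_sinh)+
    have e: "(of_real \<eta> \<cdot>\<^sub>v w s) $ i = of_real \<eta> * (cosh (\<mu> * of_real s) * x $ i)"
      "(of_real \<eta> \<cdot>\<^sub>v w s) $ (m + i) = of_real \<eta> * (\<mu> * sinh (\<mu> * of_real s) * x $ i)" for s
      using x i by (auto simp: w_def)
    show "((\<lambda>s. (of_real \<eta> \<cdot>\<^sub>v w s) $ i) has_vector_derivative (of_real \<eta> \<cdot>\<^sub>v w t) $ (m + i)) (at t within {0..})"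
      unfolding e by (rule 1)
    show "((\<lambda>s. (of_real \<eta> \<cdot>\<^sub>v w s) $ (m + i)) has_vector_derivative
        (B *\<^sub>v Matrix.vec m (\<lambda>j. (of_real \<eta> \<cdot>\<^sub>v w t) $ j)) $ i) (at t within {0..})"
      unfolding e Bw by (rule 2)
  qed (use w_carrier in simp)
  obtain k where k: "k < m" "x $ k \<noteq> 0"
    using x by (metis carrier_vecD eq_vecI index_zero_vec)
  assume "lyapunov_stable_on V (first_order B)"
  then obtain \<delta> where \<delta>: "\<delta> > 0" and
    st: "\<And>z t. is_solution (first_order B) z \<Longrightarrow> z 0 \<in> V \<Longrightarrow> eucl_norm (z 0) < \<delta> \<Longrightarrow> t \<ge> 0
      \<Longrightarrow> eucl_norm (z t) < 1"
    unfolding lyapunov_stable_on_def by (elim allE[of _ 1]) auto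
  define \<eta> where "\<eta> = \<delta> / (eucl_norm (w 0) + 1)"
  have pos: "eucl_norm (w 0) + 1 > 0" using eucl_norm_nonneg[of "w 0"] by linarith
  have \<eta>: "\<eta> > 0" using \<delta> pos by (simp add: \<eta>_def)
  have "\<eta> * eucl_norm (w 0) < \<delta>"
    using \<delta> pos by (simp add: \<eta>_def field_simps)
  then have small: "eucl_norm (of_real \<eta> \<cdot>\<^sub>v w 0) < \<delta>"
    using \<eta> by (simp add: eucl_norm_smult)
  have rest: "of_real \<eta> \<cdot>\<^sub>v w 0 \<in> V"
    using V w_carrier[of 0] x by (auto simp: w_def)
  \<comment> \<open>By \<open>norm_cosh_ge\<close>, entry \<open>k\<close> of the solution has norm at least \<open>1\<close> at this time.\<close>
  define t where "t = 2 / (\<eta> * Re \<mu> * cmod (x $ k))"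
  have t: "t \<ge> 0" using \<eta> \<mu> by (simp add: t_def)
  have "1 = \<eta> * (Re (\<mu> * of_real t) / 2 * cmod (x $ k))"
    using \<eta> \<mu> k by (simp add: t_def)
  also have "\<dots> \<le> \<eta> * (cmod (cosh (\<mu> * of_real t)) * cmod (x $ k))"
    using \<eta> \<mu> t by (intro mult_left_mono mult_right_mono norm_cosh_ge) auto
  also have "\<dots> = cmod ((of_real \<eta> \<cdot>\<^sub>v w t) $ k)"
    using x k \<eta> by (simp add: w_def norm_mult)
  also have "\<dots> \<le> eucl_norm (of_real \<eta> \<cdot>\<^sub>v w t)"
    by (rule norm_entry_le_eucl_norm) (use w_carrier[of t] k in auto)
  also have "\<dots> < 1" by (rule st[OF sol rest small t])
  finally show False by simp
qed

section \<open>Eigenvalues of the boundary matrix\<close>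

lemma boundary_mat_mult_vec:
  assumes n: "n \<ge> 1" and i: "i \<le> n"
  shows "(boundary_mat b0 b1 cm1 c0 n *\<^sub>v Matrix.vec (n + 1) f) $ i =
    (if i = 0 then - b0 * f 0 + (1 - b1) * f 1
     else if i = n then (1 - cm1) * f (n - 1) - c0 * f n
     else f (i - 1) + f (i + 1))"
proof -
  let ?A = "boundary_mat b0 b1 cm1 c0 n"
  have sum: "(?A *\<^sub>v Matrix.vec (n + 1) f) $ i = (\<Sum>j<n + 1. ?A $$ (i, j) * f j)"
    using i by (simp add: boundary_mat_def scalar_prod_def atLeast0LessThan)
  have two: "(\<Sum>j<n + 1. ?A $$ (i, j) * f j) = c * f k + d * f l"
    if "k < n + 1" "l < n + 1"
      "\<And>j. j < n + 1 \<Longrightarrow> ?A $$ (i, j) = (if j = k then c else 0) + (if j = l then d else 0)"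
    for c d k l
  proof -
    have "(\<Sum>j<n + 1. ?A $$ (i, j) * f j)
        = (\<Sum>j<n + 1. (if j = k then c * f k else 0) + (if j = l then d * f l else 0))"
      by (intro sum.cong) (auto simp: that(3) distrib_right)
    also have "\<dots> = c * f k + d * f l"
      using that(1,2) by (simp add: sum.distrib)
    finally show ?thesis .
  qed
  consider "i = 0" | "i = n" "i \<noteq> 0" | "0 < i" "i < n" using i by linarith
  then show ?thesis
  proof cases
    case 1
    then have "(\<Sum>j<n + 1. ?A $$ (i, j) * f j) = - b0 * f 0 + (1 - b1) * f 1"
      using n by (intro two) (auto simp: boundary_mat_def)
    then show ?thesis using sum 1 by simp
  next
    case 2
    then have "(\<Sum>j<n + 1. ?A $$ (i, j) * f j) = (1 - cm1) * f (n - 1) + (- c0) * f n"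
      using n by (intro two) (auto simp: boundary_mat_def)
    then show ?thesis using sum 2 by simp
  next
    case 3
    then have "(\<Sum>j<n + 1. ?A $$ (i, j) * f j) = 1 * f (i - 1) + 1 * f (i + 1)"
      by (intro two) (auto simp: boundary_mat_def)
    then show ?thesis using sum 3 by simp
  qed
qed

lemma singular_2x2_kernel:
  fixes l1 l2 m1 m2 :: "'a :: idom"
  assumes "l1 * m2 = l2 * m1"
  obtains \<alpha> \<beta> where "\<alpha> \<noteq> 0 \<or> \<beta> \<noteq> 0" "\<alpha> * l1 + \<beta> * l2 = 0" "\<alpha> * m1 + \<beta> * m2 = 0"
proof -
  consider "l1 \<noteq> 0 \<or> l2 \<noteq> 0" | "l1 = 0" "l2 = 0" "m1 \<noteq> 0 \<or> m2 \<noteq> 0"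
    | "l1 = 0" "l2 = 0" "m1 = 0" "m2 = 0" by blast
  then show ?thesis
  proof cases
    case 1
    show ?thesis by (rule that[of l2 "- l1"]) (use 1 assms in \<open>auto simp: algebra_simps\<close>)
  next
    case 2
    show ?thesis by (rule that[of m2 "- m1"]) (use 2 in \<open>auto simp: algebra_simps\<close>)
  next
    case 3
    show ?thesis by (rule that[of 1 0]) (use 3 in auto)
  qed
qed

text \<open>The assumption \<open>char\<close> is the vanishing of the determinant \<open>l1 m2 - l2 m1\<close> of the boundary
  conditions for \<open>\<alpha> u\<^sup>k + \<beta> u\<^sup>-\<^sup>k\<close>, multiplied by \<open>u\<^sup>n\<^sup>+\<^sup>2\<close> to clear denominators.  The condition
  \<open>u\<^sup>2 \<noteq> 1\<close> makes the two geometric sequences linearly independent, so that the vector is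
  nonzero.\<close>

lemma boundary_mat_eigenvector:
  fixes u :: complex
  assumes n: "n \<ge> 1" and u: "u \<noteq> 0" "u\<^sup>2 \<noteq> 1"
    and char: "(1 + b0 * u + b1 * u\<^sup>2) * (1 + c0 * u + cm1 * u\<^sup>2)
      = u ^ (2 * n) * ((u\<^sup>2 + b0 * u + b1) * (u\<^sup>2 + c0 * u + cm1))"
  obtains x where "x \<in> carrier_vec (n + 1)" "x \<noteq> 0\<^sub>v (n + 1)"
    "boundary_mat b0 b1 cm1 c0 n *\<^sub>v x = (u + 1 / u) \<cdot>\<^sub>v x"
proof -
  obtain k where nk: "n = Suc k" using n by (cases n) auto
  define v where "v = 1 / u"
  have uv: "u * v = 1" using u by (simp add: v_def)
  \<comment> \<open>Residuals of \<open>u\<^sup>j\<close> and \<open>v\<^sup>j\<close> in the two boundary rows: row \<open>0\<close> for \<open>l1\<close>, \<open>l2\<close>, row \<open>n\<close> for \<open>m1\<close>, \<open>m2\<close>.\<close>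
  define l1 l2 m1 m2 where "l1 = v + b0 + b1 * u" and "l2 = u + b0 + b1 * v"
    and "m1 = u ^ k * (u\<^sup>2 + c0 * u + cm1)" and "m2 = v ^ k * (v\<^sup>2 + c0 * v + cm1)"
  have "u * l1 = 1 + b0 * u + b1 * u\<^sup>2" "u * l2 = u\<^sup>2 + b0 * u + b1"
    using uv by (simp_all add: l1_def l2_def algebra_simps power2_eq_square)
  moreover have "u ^ (k + 2) * m2 = 1 + c0 * u + cm1 * u\<^sup>2"
  proof -
    have "u ^ (k + 2) * m2 = (u * v) ^ k * ((u * v)\<^sup>2 + c0 * u * (u * v) + cm1 * u\<^sup>2)"
      by (simp add: m2_def power_mult_distrib power2_eq_square algebra_simps)
    then show ?thesis using uv by simp
  qed
  moreover have "u ^ (k + 2) * m1 = u ^ (2 * n) * (u\<^sup>2 + c0 * u + cm1)"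
    by (simp add: m1_def nk mult_2 power_add power2_eq_square)
  ultimately have "(u * l1) * (u ^ (k + 2) * m2) = (u * l2) * (u ^ (k + 2) * m1)"
    using char by (simp add: mult_ac)
  then have "(u * u ^ (k + 2)) * (l1 * m2) = (u * u ^ (k + 2)) * (l2 * m1)"
    by (simp only: mult_ac)
  then have "l1 * m2 = l2 * m1" using u by simp
  then obtain \<alpha> \<beta> where ab: "\<alpha> \<noteq> 0 \<or> \<beta> \<noteq> 0" "\<alpha> * l1 + \<beta> * l2 = 0" "\<alpha> * m1 + \<beta> * m2 = 0"
    by (rule singular_2x2_kernel)
  define f where "f j = \<alpha> * u ^ j + \<beta> * v ^ j" for j
  have rec: "(u + v) * f (Suc j) = f j + f (Suc (Suc j))" for j
  proof -
    have "(u + v) * f (Suc j) = f (Suc (Suc j)) + (u * v) * f j"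
      by (simp add: f_def algebra_simps)
    then show ?thesis using uv by simp
  qed
  have left: "(u + v) * f 0 - f 1 + b0 * f 0 + b1 * f 1 = 0"
    using ab(2) by (simp add: f_def l1_def l2_def algebra_simps)
  have right: "f (n + 1) + c0 * f n + cm1 * f k = 0"
    using ab(3) by (simp add: f_def m1_def m2_def nk algebra_simps power2_eq_square)
  show ?thesis
  proof
    show "Matrix.vec (n + 1) f \<in> carrier_vec (n + 1)" by simp
    show "Matrix.vec (n + 1) f \<noteq> 0\<^sub>v (n + 1)"
    proof
      assume 0: "Matrix.vec (n + 1) f = 0\<^sub>v (n + 1)"
      have f0: "f j = 0" if "j < n + 1" for j
        using arg_cong[OF 0, of "\<lambda>w. w $ j"] that by simp
      have "\<alpha> + \<beta> = 0" "\<alpha> * u + \<beta> * v = 0" using f0[of 0] f0[of 1] n by (auto simp: f_def)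
      then have "\<beta> = - \<alpha>" "\<alpha> * u + \<beta> * v = 0" by (auto simp: add_eq_0_iff)
      then have "\<beta> = - \<alpha>" "\<alpha> * (u - v) = 0" by (auto simp: algebra_simps)
      then have "u = v" using ab(1) by auto
      then show False using uv u by (simp add: power2_eq_square)
    qed
    show "boundary_mat b0 b1 cm1 c0 n *\<^sub>v Matrix.vec (n + 1) f = (u + 1 / u) \<cdot>\<^sub>v Matrix.vec (n + 1) f"
    proof (rule eq_vecI)
      fix i assume "i < dim_vec ((u + 1 / u) \<cdot>\<^sub>v Matrix.vec (n + 1) f)"
      then have i: "i \<le> n" by simp
      consider "i = 0" | "i = n" "i \<noteq> 0" | j where "i = Suc j" "i < n" using i by (cases i) force+
      then have "(boundary_mat b0 b1 cm1 c0 n *\<^sub>v Matrix.vec (n + 1) f) $ i = (u + v) * f i"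
      proof cases
        case 1
        then show ?thesis unfolding boundary_mat_mult_vec[OF n i]
          using left by (simp add: algebra_simps)
      next
        case 2
        then show ?thesis unfolding boundary_mat_mult_vec[OF n i]
          using right rec[of k] by (simp add: nk algebra_simps)
      next
        case 3
        then show ?thesis unfolding boundary_mat_mult_vec[OF n i]
          using rec by simp
      qed
      then show "(boundary_mat b0 b1 cm1 c0 n *\<^sub>v Matrix.vec (n + 1) f) $ i
          = ((u + 1 / u) \<cdot>\<^sub>v Matrix.vec (n + 1) f) $ i"
        using i by (simp add: v_def)
    qed (simp add: boundary_mat_def)
  qed
qed

section \<open>Roots of the characteristic equation near a root of its limit\<close>

text \<open>On a small circle around \<open>r\<close> that avoids the zeros of \<open>S\<close>, the perturbation \<open>u\<^sup>n T(u)\<close> is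
  eventually less than half the minimum \<open>m\<close> of \<open>\<bar>S\<bar>\<close>.  If \<open>h = S - u\<^sup>n T\<close> had no zero in the disc,
  the maximum modulus principle for \<open>1/h\<close> would give \<open>\<bar>h(r)\<bar> \<ge> m/2\<close>, whereas
  \<open>\<bar>h(r)\<bar> = \<bar>r\<^sup>n T(r)\<bar> < m/2\<close>.\<close>

lemma eventually_root_near:
  fixes S T :: "complex poly"
  assumes S: "S \<noteq> 0" "poly S r = 0" and r: "cmod r < 1" and e: "e > 0"
  shows "\<forall>\<^sub>F n in sequentially. \<exists>u. dist r u < e \<and> poly S u = u ^ n * poly T u"
proof -
  have "finite (dist r ` {z. poly S z = 0})" using poly_roots_finite[OF S(1)] by simp
  moreover have "infinite {0<..<min e (1 - cmod r)}" using e r by simp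
  ultimately have "\<not> {0<..<min e (1 - cmod r)} \<subseteq> dist r ` {z. poly S z = 0}"
    using finite_subset by blast
  then obtain \<rho> where "\<rho> \<in> {0<..<min e (1 - cmod r)}" "\<rho> \<notin> dist r ` {z. poly S z = 0}"
    by blast
  then have \<rho>: "0 < \<rho>" "\<rho> < e" "cmod r + \<rho> < 1" "\<rho> \<notin> dist r ` {z. poly S z = 0}"
    by auto
  have "\<exists>m>0. \<forall>z\<in>sphere r \<rho>. m \<le> cmod (poly S z)"
  proof -
    have "compact (sphere r \<rho>)" "sphere r \<rho> \<noteq> {}" using \<rho> by auto
    moreover have "continuous_on (sphere r \<rho>) (\<lambda>z. cmod (poly S z))"
      by (intro continuous_on_norm continuous_on_poly continuous_on_id)
    ultimately have "\<exists>z\<in>sphere r \<rho>. \<forall>y\<in>sphere r \<rho>. cmod (poly S z) \<le> cmod (poly S y)"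
      by (rule continuous_attains_inf)
    then obtain z where z: "z \<in> sphere r \<rho>" "\<forall>y\<in>sphere r \<rho>. cmod (poly S z) \<le> cmod (poly S y)"
      by (rule bexE)
    then have "poly S z \<noteq> 0" using \<rho>(4) by auto
    then show ?thesis using z by (intro exI[of _ "cmod (poly S z)"]) auto
  qed
  then obtain m where m: "m > 0" "\<And>z. z \<in> sphere r \<rho> \<Longrightarrow> m \<le> cmod (poly S z)" by blast
  have "bounded (poly T ` cball r \<rho>)"
    by (intro compact_imp_bounded compact_continuous_image compact_cball
        continuous_on_poly continuous_on_id)
  then obtain K where K: "\<And>z. z \<in> cball r \<rho> \<Longrightarrow> cmod (poly T z) \<le> K"
    unfolding bounded_iff by blast
  have "(\<lambda>n. (cmod r + \<rho>) ^ n * K) \<longlonglongrightarrow> 0"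
  proof (intro tendsto_mult_left_zero LIMSEQ_power_zero)
    have "0 \<le> cmod r + \<rho>" using \<rho>(1) norm_ge_zero[of r] by linarith
    then show "norm (cmod r + \<rho>) < 1" using \<rho>(3) by simp
  qed
  then have "\<forall>\<^sub>F n in sequentially. (cmod r + \<rho>) ^ n * K < m / 2"
    by (rule order_tendstoD) (use m in simp)
  then show ?thesis
  proof eventually_elim
    case (elim n)
    define h where "h z = poly S z - z ^ n * poly T z" for z
    have err: "cmod (z ^ n * poly T z) < m / 2" if "z \<in> cball r \<rho>" for z
    proof -
      have "cmod z \<le> cmod r + \<rho>" using that norm_triangle_sub[of z r]
        by (simp add: dist_norm norm_minus_commute)
      then have "cmod (z ^ n * poly T z) \<le> (cmod r + \<rho>) ^ n * K"
        unfolding norm_mult norm_power using K[OF that] \<rho>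
        by (intro mult_mono power_mono) auto
      then show ?thesis using elim by simp
    qed
    have "\<exists>u\<in>cball r \<rho>. h u = 0"
    proof (rule ccontr)
      assume no: "\<not> (\<exists>u\<in>cball r \<rho>. h u = 0)"
      have hol: "h holomorphic_on UNIV" unfolding h_def by (intro holomorphic_intros)
      have inv: "(\<lambda>z. inverse (h z)) holomorphic_on cball r \<rho>"
        using no by (intro holomorphic_intros holomorphic_on_subset[OF hol]) auto
      have "cmod (inverse (h r)) \<le> inverse (m / 2)"
      proof (rule maximum_modulus_frontier[of "\<lambda>z. inverse (h z)" "cball r \<rho>"])
        show "(\<lambda>z. inverse (h z)) holomorphic_on interior (cball r \<rho>)"
          using inv holomorphic_on_subset interior_subset by blast
        show "continuous_on (closure (cball r \<rho>)) (\<lambda>z. inverse (h z))"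
          using holomorphic_on_imp_continuous_on[OF inv] by simp
        fix z assume "z \<in> frontier (cball r \<rho>)"
        then have z: "z \<in> sphere r \<rho>" "z \<in> cball r \<rho>" by auto
        have "cmod (poly S z) - cmod (z ^ n * poly T z) \<le> cmod (h z)"
          unfolding h_def by (rule norm_triangle_ineq2)
        then have "m / 2 \<le> cmod (h z)" using m(2)[OF z(1)] err[OF z(2)] by linarith
        then show "cmod (inverse (h z)) \<le> inverse (m / 2)"
          unfolding norm_inverse by (rule le_imp_inverse_le) (use m(1) in simp)
      qed (use \<rho> in auto)
      moreover have "0 < cmod (h r)" using no \<rho> by simp
      ultimately have "m / 2 \<le> cmod (h r)"
        unfolding norm_inverse by (rule inverse_le_imp_le)
      then show False using err[of r] \<rho> S(2) by (simp add: h_def norm_mult)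
    qed
    then obtain u where "dist r u \<le> \<rho>" "poly S u = u ^ n * poly T u" by (auto simp: h_def)
    moreover from this(1) have "dist r u < e" using \<rho>(2) by linarith
    ultimately show ?case by blast
  qed
qed

text \<open>Both conclusions follow from \<open>\<bar>r\<bar>\<^sup>2 < a / (2 - a)\<close> for \<open>r = a + b i\<close>, since
  \<open>Re (r + 1/r) = a + a / \<bar>r\<bar>\<^sup>2\<close>.\<close>

lemma Re_add_inverse_gt_2:
  fixes a b :: real
  assumes "0 < a" "a < 1" "\<bar>b\<bar> < sqrt (a / (2 - a) - a\<^sup>2)"
  shows "cmod (Complex a b) < 1" "2 < Re (Complex a b + 1 / Complex a b)"
proof -
  have "b\<^sup>2 < a / (2 - a) - a\<^sup>2"
    using assms(3) by (metis real_sqrt_abs real_sqrt_less_iff)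
  then have ab: "a\<^sup>2 + b\<^sup>2 < a / (2 - a)" by simp
  have "a / (2 - a) < 1" using assms by simp
  with ab show "cmod (Complex a b) < 1" by (simp add: complex_norm)
  have pos: "0 < a\<^sup>2 + b\<^sup>2" using assms by (simp add: add_pos_nonneg)
  have "(2 - a) * (a\<^sup>2 + b\<^sup>2) < a" using ab assms by (simp add: pos_less_divide_eq mult.commute)
  then have "2 - a < a / (a\<^sup>2 + b\<^sup>2)" using pos by (simp only: pos_less_divide_eq)
  then show "2 < Re (Complex a b + 1 / Complex a b)"
    by (simp add: Re_divide)
qed

section \<open>The periodic system\<close>

lemma lyapunov_stable_onI:
  assumes "\<And>z t. is_solution M z \<Longrightarrow> z 0 \<in> V \<Longrightarrow> t \<ge> 0 \<Longrightarrow> eucl_norm (z t) \<le> C * eucl_norm (z 0)"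
  shows "lyapunov_stable_on V M"
  unfolding lyapunov_stable_on_def
proof (intro allI impI)
  fix \<epsilon> :: real assume \<epsilon>: "\<epsilon> > 0"
  have C: "C < \<bar>C\<bar> + 1" "\<bar>C\<bar> + 1 > 0" by auto
  show "\<exists>\<delta>>0. \<forall>z. is_solution M z \<and> z 0 \<in> V \<and> eucl_norm (z 0) < \<delta> \<longrightarrow> (\<forall>t\<ge>0. eucl_norm (z t) < \<epsilon>)"
  proof (intro exI[of _ "\<epsilon> / (\<bar>C\<bar> + 1)"] conjI allI impI)
    show "\<epsilon> / (\<bar>C\<bar> + 1) > 0" using \<epsilon> C by simp
    fix z and t :: real
    assume z: "is_solution M z \<and> z 0 \<in> V \<and> eucl_norm (z 0) < \<epsilon> / (\<bar>C\<bar> + 1)" and t: "0 \<le> t"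
    have "eucl_norm (z t) \<le> C * eucl_norm (z 0)" using assms z t by blast
    also have "\<dots> \<le> (\<bar>C\<bar> + 1) * eucl_norm (z 0)"
      using C eucl_norm_nonneg by (intro mult_right_mono) auto
    also have "\<dots> < \<epsilon>" using z C by (simp add: field_simps)
    finally show "eucl_norm (z t) < \<epsilon>" .
  qed
qed

lemma sum_cyclic_shift:
  fixes f :: "nat \<Rightarrow> 'a :: comm_monoid_add"
  shows "(\<Sum>i<n + 1. f ((i + 1) mod (n + 1))) = (\<Sum>i<n + 1. f i)"
proof -
  have "(\<Sum>i<n + 1. f ((i + 1) mod (n + 1))) = (\<Sum>i<n. f (Suc i)) + f 0"
    by (simp add: sum.lessThan_Suc)
  also have "\<dots> = (\<Sum>i<n + 1. f i)"
    unfolding Suc_eq_plus1[symmetric] sum.lessThan_Suc_shift by (simp add: add.commute)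
  finally show ?thesis .
qed

lemma periodic_mat_mult_vec:
  assumes n: "n \<ge> 2" and i: "i < n + 1"
  shows "(periodic_mat n *\<^sub>v Matrix.vec (n + 1) f) $ i
    = f ((i + 1) mod (n + 1)) - 2 * f i + f ((i + n) mod (n + 1))"
proof -
  define s where "s = (i + 1) mod (n + 1)"
  define p where "p = (i + n) mod (n + 1)"
  have s: "s = (if i = n then 0 else i + 1)" using i by (auto simp: s_def)
  have p: "p = (if i = 0 then n else i - 1)"
  proof (cases "i = 0")
    case False
    then have "i + n = (i - 1) + (n + 1)" by simp
    then have "p = (i - 1) mod (n + 1)" unfolding p_def by (metis mod_add_self2)
    then show ?thesis using False i by simp
  qed (simp add: p_def)
  have "(periodic_mat n *\<^sub>v Matrix.vec (n + 1) f) $ i = (\<Sum>j<n + 1. periodic_mat n $$ (i, j) * f j)"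
    using i by (simp add: periodic_mat_def scalar_prod_def atLeast0LessThan)
  also have "\<dots> = (\<Sum>j<n + 1. (if j = i then - 2 * f i else 0) + (if j = s then f s else 0) + (if j = p then f p else 0))"
  proof (rule sum.cong)
    fix j assume "j \<in> {..<n + 1}"
    then have j: "j < n + 1" by simp
    have "i = (j + 1) mod (n + 1) \<longleftrightarrow> j = p"
      unfolding p using i j n by (cases "j = n") auto
    then have "periodic_mat n $$ (i, j) = (if i = j then - 2 else if j = s \<or> j = p then 1 else 0)"
      using i j by (simp add: periodic_mat_def s_def)
    then show "periodic_mat n $$ (i, j) * f j = (if j = i then - 2 * f i else 0) + (if j = s then f s else 0) + (if j = p then f p else 0)"
      unfolding s p using n by auto
  qed simp
  also have "\<dots> = f s - 2 * f i + f p"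
  proof -
    have "s < n + 1" "p < n + 1" by (simp_all add: s_def p_def)
    then show ?thesis unfolding sum.distrib using i by simp
  qed
  finally show ?thesis unfolding s_def p_def .
qed

text \<open>With the cyclic shift \<open>s\<close> and the differences \<open>d i = x (s i) - x i\<close> the system reads
  \<open>v' i = q (d i - d (p i))\<close>, where \<open>p\<close> is the inverse of \<open>s\<close>.  Summation by parts over the cycle has no
  boundary terms, which gives conservation of energy and of total momentum.\<close>

lemma lyapunov_stable_on_periodic:
  assumes q: "q > 0" and n: "n \<ge> 2"
  shows "lyapunov_stable_on (zero_mean_velocity (n + 1)) (first_order (complex_of_real q \<cdot>\<^sub>m periodic_mat n))"
proof -
  define m where "m = n + 1"
  define s where "s i = (i + 1) mod m" for i
  define p where "p i = (i + n) mod m" for i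
  let ?B = "complex_of_real q \<cdot>\<^sub>m periodic_mat n"
  have B: "?B \<in> carrier_mat m m" by (simp add: m_def periodic_mat_def)
  have shift: "(\<Sum>i<m. f (s i)) = (\<Sum>i<m. f i)" for f :: "nat \<Rightarrow> 'b :: comm_monoid_add"
    using sum_cyclic_shift[of f n] by (simp add: s_def m_def)
  have sm: "s i < m" "p i < m" for i by (auto simp: s_def p_def m_def)
  have ps: "p (s i) = i" if "i < m" for i
  proof -
    have "p (s i) = (i + (n + 1)) mod (n + 1)"
      by (simp add: p_def s_def m_def mod_simps)
    then show ?thesis using that by (simp only: mod_add_self2) (simp add: m_def)
  qed
  have sp: "s (p i) = i" if "i < m" for i
  proof -
    have "s (p i) = (i + (n + 1)) mod (n + 1)"
      by (simp add: p_def s_def m_def mod_simps)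
    then show ?thesis using that by (simp only: mod_add_self2) (simp add: m_def)
  qed
  \<comment> \<open>If all entries of the initial state have norm at most \<open>N\<close>, its energy is at most \<open>(C N)\<^sup>2\<close>.\<close>
  define C where "C = sqrt (real m * (1 + 4 * q))"
  define D where "D = C + (1 + 2 * real m * (C / sqrt q))"
  have C: "C \<ge> 0" using q by (simp add: C_def)
  show ?thesis
    unfolding m_def[symmetric]
  proof (rule lyapunov_stable_onI)
    fix z and t :: real
    assume sol: "is_solution (first_order ?B) z" and z0: "z 0 \<in> zero_mean_velocity m" and t: "t \<ge> 0"
    define x where "x t i = z t $ i" for t i
    define v where "v t i = z t $ (m + i)" for t i
    define d where "d t i = x t (s i) - x t i" for t i
    define N where "N = eucl_norm (z 0)"
    have zc: "z t \<in> carrier_vec (2 * m)" if "t \<ge> 0" for t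
      using sol that unfolding is_solution_first_order_iff[OF B] by blast
    have N: "N \<ge> 0" "\<And>i. i < m \<Longrightarrow> cmod (x 0 i) \<le> N" "\<And>i. i < m \<Longrightarrow> cmod (v 0 i) \<le> N"
      unfolding N_def x_def v_def using zc[of 0]
      by (auto intro!: norm_entry_le_eucl_norm eucl_norm_nonneg)
    have dx: "((\<lambda>\<tau>. x \<tau> i) has_vector_derivative v t i) (at t within {0..})" if "t \<ge> 0" "i < m" for t i
      using sol that unfolding is_solution_first_order_iff[OF B] x_def v_def by blast
    have dv: "((\<lambda>\<tau>. v \<tau> i) has_vector_derivative of_real q * (d t i - d t (p i))) (at t within {0..})"
      if "t \<ge> 0" "i < m" for t i
    proof -
      have "(?B *\<^sub>v Matrix.vec m (\<lambda>j. z t $ j)) $ i = of_real q * ((periodic_mat n *\<^sub>v Matrix.vec m (\<lambda>j. z t $ j)) $ i)"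
        using that by (simp add: periodic_mat_def m_def smult_mat_mult_vec del: index_mult_mat_vec)
      also have "(periodic_mat n *\<^sub>v Matrix.vec m (\<lambda>j. z t $ j)) $ i = x t (s i) - 2 * x t i + x t (p i)"
        using periodic_mat_mult_vec[OF n, of i "\<lambda>j. z t $ j"] that by (simp add: x_def s_def p_def m_def)
      also have "\<dots> = d t i - d t (p i)"
        using sp[OF that(2)] by (simp add: d_def)
      finally show ?thesis
        using sol that unfolding is_solution_first_order_iff[OF B] v_def by metis
    qed
    have dd: "((\<lambda>\<tau>. d \<tau> i) has_vector_derivative v t (s i) - v t i) (at t within {0..})" if "t \<ge> 0" "i < m" for t i
      unfolding d_def by (intro has_vector_derivative_diff dx that sm)
    have conserved: "F t = F 0"
      if "t \<ge> 0" "\<And>t. t \<ge> 0 \<Longrightarrow> (F has_vector_derivative 0) (at t within {0..})"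
      for F :: "real \<Rightarrow> 'b :: real_normed_vector" and t
    proof -
      have "\<exists>c. \<forall>t\<in>{0..}. F t = c"
        by (rule has_derivative_zero_constant)
          (use that in \<open>auto simp: has_vector_derivative_def\<close>)
      then show ?thesis using that(1) by auto
    qed
    have V: "(\<Sum>i<m. v t i) = 0" if "t \<ge> 0" for t
    proof -
      have "(\<Sum>i<m. v t i) = (\<Sum>i<m. v 0 i)"
      proof (rule conserved[OF that])
        fix t :: real assume "t \<ge> 0"
        then have "((\<lambda>\<tau>. \<Sum>i<m. v \<tau> i) has_vector_derivative
            (\<Sum>i<m. of_real q * (d t i - d t (p i)))) (at t within {0..})"
          by (intro has_vector_derivative_sum dv) auto
        moreover have "(\<Sum>i<m. d t (p i)) = (\<Sum>i<m. d t i)"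
          using shift[of "\<lambda>i. d t (p i)"] ps by simp
        ultimately show "((\<lambda>\<tau>. \<Sum>i<m. v \<tau> i) has_vector_derivative 0) (at t within {0..})"
          by (simp add: sum_distrib_left[symmetric] sum_subtractf)
      qed
      also have "\<dots> = 0" using z0 by (simp add: zero_mean_velocity_def v_def)
      finally show ?thesis .
    qed
    have X: "(\<Sum>i<m. x t i) = (\<Sum>i<m. x 0 i)"
    proof (rule conserved[OF t])
      fix t :: real assume t: "t \<ge> 0"
      then have "((\<lambda>\<tau>. \<Sum>i<m. x \<tau> i) has_vector_derivative (\<Sum>i<m. v t i)) (at t within {0..})"
        by (intro has_vector_derivative_sum dx) auto
      then show "((\<lambda>\<tau>. \<Sum>i<m. x \<tau> i) has_vector_derivative 0) (at t within {0..})"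
        unfolding V[OF t] .
    qed
    define E where "E t = (\<Sum>i<m. inner (v t i) (v t i)) + q * (\<Sum>i<m. inner (d t i) (d t i))" for t
    have E: "E t = E 0"
    proof (rule conserved[OF t])
      fix t :: real assume t: "t \<ge> 0"
      note inner_deriv = bounded_bilinear.has_vector_derivative[OF bounded_bilinear_inner]
      let ?a = "\<lambda>i. of_real q * (d t i - d t (p i))"
      let ?b = "\<lambda>i. v t (s i) - v t i"
      have "(E has_vector_derivative (\<Sum>i<m. inner (v t i) (?a i) + inner (?a i) (v t i))
          + q * (\<Sum>i<m. inner (d t i) (?b i) + inner (?b i) (d t i))) (at t within {0..})"
        unfolding E_def
        by (intro has_vector_derivative_add has_vector_derivative_mult_right has_vector_derivative_sum
            inner_deriv dv dd t) auto
      also have "(\<Sum>i<m. inner (v t i) (?a i) + inner (?a i) (v t i))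
          = 2 * q * ((\<Sum>i<m. inner (v t i) (d t i)) - (\<Sum>i<m. inner (v t i) (d t (p i))))"
      proof -
        have "inner (v t i) (?a i) + inner (?a i) (v t i)
            = 2 * q * (inner (v t i) (d t i) - inner (v t i) (d t (p i)))" for i
          by (simp add: scaleR_conv_of_real[symmetric] inner_diff_right inner_commute)
        then show ?thesis by (simp only: sum_distrib_left[symmetric] sum_subtractf)
      qed
      also have "(\<Sum>i<m. inner (v t i) (d t (p i))) = (\<Sum>i<m. inner (v t (s i)) (d t i))"
        using shift[of "\<lambda>i. inner (v t i) (d t (p i))"] ps by simp
      also have "(\<Sum>i<m. inner (d t i) (?b i) + inner (?b i) (d t i))
          = 2 * ((\<Sum>i<m. inner (v t (s i)) (d t i)) - (\<Sum>i<m. inner (v t i) (d t i)))"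
      proof -
        have "inner (d t i) (?b i) + inner (?b i) (d t i)
            = 2 * (inner (v t (s i)) (d t i) - inner (v t i) (d t i))" for i
          by (simp add: inner_diff_left inner_diff_right inner_commute)
        then show ?thesis by (simp only: sum_distrib_left[symmetric] sum_subtractf)
      qed
      finally show "(E has_vector_derivative 0) (at t within {0..})"
        by (simp add: algebra_simps)
    qed
    have "E 0 \<le> (\<Sum>i<m. N\<^sup>2) + q * (\<Sum>i<m. (2 * N)\<^sup>2)"
      unfolding E_def power2_norm_eq_inner[symmetric]
    proof (intro add_mono mult_left_mono sum_mono power_mono)
      fix i assume "i \<in> {..<m}"
      then have "cmod (d 0 i) \<le> N + N"
        unfolding d_def using N(2)[of i] N(2)[of "s i"] sm by (intro norm_triangle_le_diff) auto
      then show "cmod (d 0 i) \<le> 2 * N" by simp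
    qed (use N q in auto)
    also have "\<dots> = (C * N)\<^sup>2"
      using q by (simp add: C_def power_mult_distrib algebra_simps)
    finally have Eb: "E t \<le> (C * N)\<^sup>2" using E by simp
    have sq: "(cmod (v t i))\<^sup>2 + q * (cmod (d t i))\<^sup>2 \<le> (C * N)\<^sup>2" if "i < m" for i
    proof -
      have "(cmod (v t i))\<^sup>2 + q * (cmod (d t i))\<^sup>2 \<le> E t"
        unfolding E_def power2_norm_eq_inner[symmetric] using q that
        by (intro add_mono mult_left_mono member_le_sum) auto
      then show ?thesis using Eb by linarith
    qed
    have vb: "cmod (v t i) \<le> C * N" if "i < m" for i
    proof (rule power2_le_imp_le)
      have "0 \<le> q * (cmod (d t i))\<^sup>2" using q by simp
      then show "(cmod (v t i))\<^sup>2 \<le> (C * N)\<^sup>2" using sq[OF that] by linarith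
    qed (use C N in simp)
    define K where "K = C / sqrt q * N"
    have K: "K \<ge> 0" using C N q by (simp add: K_def)
    have db: "cmod (d t i) \<le> K" if "i < m" for i
    proof (rule power2_le_imp_le[OF _ K])
      have "0 \<le> (cmod (v t i))\<^sup>2" by simp
      then have "q * (cmod (d t i))\<^sup>2 \<le> (C * N)\<^sup>2" using sq[OF that] by linarith
      also have "\<dots> = q * K\<^sup>2"
        using q by (simp add: K_def power_mult_distrib power_divide)
      finally show "(cmod (d t i))\<^sup>2 \<le> K\<^sup>2" using q by simp
    qed
    have "cmod (x t i - x t 0) \<le> real i * K" if "i < m" for i
      using that
    proof (induction i)
      case (Suc i)
      have "x t (Suc i) - x t 0 = d t i + (x t i - x t 0)"
        using Suc.prems by (simp add: d_def s_def)
      also have "cmod \<dots> \<le> K + real i * K"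
        using Suc by (intro norm_triangle_mono db) auto
      finally show ?case by (simp add: algebra_simps)
    qed simp
    moreover have "real i * K \<le> real m * K" if "i < m" for i
      using that K by (intro mult_right_mono) auto
    ultimately have spread: "cmod (x t i - x t 0) \<le> real m * K" if "i < m" for i
      using that by (meson order_trans)
    have xb: "cmod (x t i) \<le> N + 2 * real m * K" if "i < m" for i
    proof -
      \<comment> \<open>The conserved sum of the positions fixes \<open>x t 0\<close> up to the spread of the positions.\<close>
      have "of_nat m * x t 0 = (\<Sum>i<m. x 0 i) - (\<Sum>i<m. x t i - x t 0)"
        by (simp add: sum_subtractf X)
      also have "cmod \<dots> \<le> real m * N + real m * (real m * K)"
      proof (rule norm_triangle_le_diff[OF add_mono])
        show "cmod (\<Sum>i<m. x 0 i) \<le> real m * N"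
          using sum_norm_bound[of "{..<m}" "x 0" N] N by simp
        show "cmod (\<Sum>i<m. x t i - x t 0) \<le> real m * (real m * K)"
          using sum_norm_bound[of "{..<m}" "\<lambda>i. x t i - x t 0"] spread by simp
      qed
      finally have "real m * cmod (x t 0) \<le> real m * (N + real m * K)"
        by (simp add: norm_mult algebra_simps)
      then have "cmod (x t 0) \<le> N + real m * K" by (simp add: m_def)
      then show ?thesis
        using spread[OF that] norm_triangle_sub[of "x t i" "x t 0"] by linarith
    qed
    have D: "D * N = C * N + (N + 2 * real m * K)"
      by (simp add: D_def K_def algebra_simps)
    have "eucl_norm (z t) \<le> real (dim_vec (z t)) * (D * N)"
    proof (rule eucl_norm_le)
      fix i assume "i < dim_vec (z t)"
      then have i: "i < 2 * m" using zc[OF t] by auto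
      have nonneg: "0 \<le> C * N" "0 \<le> N + 2 * real m * K" using C N K by auto
      show "cmod (z t $ i) \<le> D * N"
      proof (cases "i < m")
        case True
        then show ?thesis using xb[of i] nonneg unfolding D x_def by linarith
      next
        case False
        then obtain k where "i = m + k" "k < m"
          using i by (metis add_less_cancel_left le_Suc_ex mult_2 not_less)
        then show ?thesis using vb[of k] nonneg unfolding D v_def by auto
      qed
    qed
    then show "eucl_norm (z t) \<le> (2 * real m * D) * eucl_norm (z 0)"
      using zc[OF t] by (simp add: N_def mult.assoc)
  qed
qed

section \<open>Instability with boundary conditions, stability with periodicity\<close>

theorem theorem7p1:
  fixes q a b :: real and b0 b1 cm1 c0 r1 r2 :: complex
  assumes "q > 0"
    and "r1 = Complex a b"
    and "0 < a" "a < 1"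
    and "\<bar>b\<bar> < sqrt (a / (2 - a) - a\<^sup>2)"
    and "r2 \<noteq> 0"
    and "(b0 = - (1 / r1) - 1 / r2 \<and> b1 = 1 / (r1 * r2)) \<or>
         (c0 = - (1 / r1) - 1 / r2 \<and> cm1 = 1 / (r1 * r2))"
  shows "\<forall>\<^sub>F n in sequentially.
    (let M = first_order (complex_of_real q \<cdot>\<^sub>m (boundary_mat b0 b1 cm1 c0 n - 2 \<cdot>\<^sub>m 1\<^sub>m (n + 1)));
         P = first_order (complex_of_real q \<cdot>\<^sub>m periodic_mat n)
     in \<not> lyapunov_stable M \<and>
        \<not> lyapunov_stable_on (zero_mean_velocity (n + 1)) M \<and>
        lyapunov_stable_on (zero_mean_velocity (n + 1)) P)"
proof -
  define S where "S = [:1, b0, b1:] * [:1, c0, cm1:]"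
  define T where "T = [:b1, b0, 1:] * [:cm1, c0, 1:]"
  have r1: "cmod r1 < 1" "2 < Re (r1 + 1 / r1)"
    using Re_add_inverse_gt_2[OF assms(3-5)] assms(2) by simp_all
  have r1_0: "r1 \<noteq> 0" using r1(2) by auto
  have fact: "1 + r1 * (- (1 / r1) - 1 / r2 + r1 * (1 / (r1 * r2))) = 0"
    using r1_0 assms(6) by (simp add: field_simps)
  have S: "S \<noteq> 0" "poly S r1 = 0"
    using assms(7) fact unfolding S_def poly_mult by auto
  have "((\<lambda>u. Re (u + 1 / u)) \<longlongrightarrow> Re (r1 + 1 / r1)) (at r1)"
    using r1_0 by (intro tendsto_intros)
  then have "\<forall>\<^sub>F u in at r1. 2 < Re (u + 1 / u)"
    using r1(2) by (rule order_tendstoD)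
  then obtain e where e: "e > 0" "\<And>u. dist r1 u < e \<Longrightarrow> 2 < Re (u + 1 / u)"
    using r1(2) unfolding eventually_at by (metis UNIV_I dist_commute)
  \<comment> \<open>The exponent in the characteristic equation runs through the even numbers only.\<close>
  have "\<forall>\<^sub>F n in sequentially. \<exists>u. dist r1 u < e \<and> poly S u = u ^ (2 * n) * poly T u"
    using eventually_root_near[OF S r1(1) e(1), of T]
    by (rule eventually_compose_filterlim) (auto intro!: filterlim_subseq simp: strict_mono_def)
  then show ?thesis
    using eventually_ge_at_top[of 2]
  proof eventually_elim
    case (elim n)
    let ?A = "boundary_mat b0 b1 cm1 c0 n"
    let ?B = "complex_of_real q \<cdot>\<^sub>m (?A - 2 \<cdot>\<^sub>m 1\<^sub>m (n + 1))"
    from elim(1) obtain u where u: "dist r1 u < e" "poly S u = u ^ (2 * n) * poly T u" by blast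
    have Re: "2 < Re (u + 1 / u)" using e u by blast
    then have "u \<noteq> 0" "u\<^sup>2 \<noteq> 1" by (auto simp: power2_eq_1_iff)
    moreover have "(1 + b0 * u + b1 * u\<^sup>2) * (1 + c0 * u + cm1 * u\<^sup>2)
        = u ^ (2 * n) * ((u\<^sup>2 + b0 * u + b1) * (u\<^sup>2 + c0 * u + cm1))"
      using u(2) by (simp add: S_def T_def power2_eq_square algebra_simps)
    moreover have "n \<ge> 1" using elim(2) by simp
    ultimately obtain x where x: "x \<in> carrier_vec (n + 1)" "x \<noteq> 0\<^sub>v (n + 1)"
      "?A *\<^sub>v x = (u + 1 / u) \<cdot>\<^sub>v x"
      by (metis boundary_mat_eigenvector)
    define \<mu> where "\<mu> = csqrt (of_real q * (u + 1 / u - 2))"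
    have \<mu>2: "\<mu>\<^sup>2 = of_real q * (u + 1 / u - 2)" by (simp add: \<mu>_def)
    have "0 < Re (\<mu>\<^sup>2)" unfolding \<mu>2 using Re assms(1) by simp
    then have "Re \<mu> \<noteq> 0" by (auto simp: power2_eq_square)
    then have "0 < Re \<mu>" using csqrt_principal[of "of_real q * (u + 1 / u - 2)"] by (auto simp: \<mu>_def)
    have A: "?A \<in> carrier_mat (n + 1) (n + 1)" by (simp add: boundary_mat_def)
    then have B: "?B \<in> carrier_mat (n + 1) (n + 1)" by (intro carrier_matI) auto
    have "?B *\<^sub>v x = of_real q \<cdot>\<^sub>v ((?A - 2 \<cdot>\<^sub>m 1\<^sub>m (n + 1)) *\<^sub>v x)"
      using A x(1) by (intro smult_mat_mult_vec) auto
    also have "(?A - 2 \<cdot>\<^sub>m 1\<^sub>m (n + 1)) *\<^sub>v x = ?A *\<^sub>v x - 2 \<cdot>\<^sub>v x"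
      using A x(1) by (simp add: minus_mult_distrib_mat_vec[where nr = "n + 1" and nc = "n + 1"]
          smult_mat_mult_vec)
    also have "of_real q \<cdot>\<^sub>v (?A *\<^sub>v x - 2 \<cdot>\<^sub>v x) = \<mu>\<^sup>2 \<cdot>\<^sub>v x"
      unfolding x(3) \<mu>2 using x(1) by (intro eq_vecI) (auto simp: algebra_simps)
    finally have eig: "?B *\<^sub>v x = \<mu>\<^sup>2 \<cdot>\<^sub>v x" .
    \<comment> \<open>A state at rest has zero mean velocity, so one growing mode settles both instability claims.\<close>
    note unstable = not_lyapunov_stable_on_if_eigenvector[OF B x(1,2) eig \<open>0 < Re \<mu>\<close>]
    show ?case
      unfolding Let_def lyapunov_stable_def
      by (intro conjI unstable lyapunov_stable_on_periodic[OF assms(1) elim(2)])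
        (auto simp: zero_mean_velocity_def)
  qed
qed

end
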